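(* For every real $\varepsilon>0$ there exists $K$ such that for every integer $k\ge K$ and every positive integer $n$, the van der Waerden complex $\mathrm{vdW}(n,k)$ is homotopy equivalent to a CW-complex all of whose cells have dimension at most $(1+\varepsilon)\,\dfrac{\log k}{\log\log k}$.
   Context: For positive integers $n,k$, the van der Waerden complex $\mathrm{vdW}(n,k)$ is the (abstract) simplicial complex on the vertex set $[n]=\{1,2,\ldots,n\}$ whose facets correspond to all arithmetic progressions of length $k$ in $[n]$, that is, the sets $\{x, x+d, x+2d, \ldots, x+kd\}$ (having $k+1$ elements) where $d$ is a positive integer and $1\le x<x+kd\le n$. Thus its faces are the empty set, the singletons $\{i\}$ with $i\in[n]$, and all subsets of such progressions. Topological statements refer to its geometric realization. *)

theory Defs
  imports "HOL-Analysis.Analysis"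
begin

definition arith_prog :: "nat \<Rightarrow> nat \<Rightarrow> nat \<Rightarrow> nat set" where
  "arith_prog x d k = {x + j * d | j. j \<le> k}"

text \<open>
  An abstract simplicial complex is given by its set of faces, the empty face included.
  If \<open>n \<le> k\<close> there are no progressions and the complex is \<open>n\<close> isolated points.
\<close>

definition vdW :: "nat \<Rightarrow> nat \<Rightarrow> nat set set" where
  "vdW n k =
     {{}} \<union> {{i} | i. i \<in> {1..n}} \<union>
     {F. \<exists>x d. 0 < d \<and> 1 \<le> x \<and> x < x + k * d \<and> x + k * d \<le> n \<and> F \<subseteq> arith_prog x d k}"

text \<open>
  Points of the realization are given by barycentric coordinates. For a complex with finitely many
  vertices, such as \<^const>\<open>vdW\<close>, the topology of pointwise convergence of the coordinates is
  the usual (Euclidean) topology of the realization. The support of \<open>x\<close> is automatically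
  finite and nonempty, since otherwise the sum would be 0.
\<close>

definition geometric_realization :: "'v set set \<Rightarrow> ('v \<Rightarrow> real) topology" where
  "geometric_realization K =
     subtopology (powertop_real UNIV)
       {x. (\<forall>v. 0 \<le> x v) \<and> {v. x v \<noteq> 0} \<in> K \<and> (\<Sum>v | x v \<noteq> 0. x v) = 1}"

text \<open>
  The closed unit ball of dimension \<open>m\<close>, its interior and its boundary sphere. In dimension 0
  the first two are a single point and the last is empty.
\<close>

definition unit_disc :: "nat \<Rightarrow> (nat \<Rightarrow> real) set" where
  "unit_disc m = {x \<in> topspace (Euclidean_space m). (\<Sum>i<m. (x i)\<^sup>2) \<le> 1}"

definition unit_open_disc :: "nat \<Rightarrow> (nat \<Rightarrow> real) set" where
  "unit_open_disc m = {x \<in> topspace (Euclidean_space m). (\<Sum>i<m. (x i)\<^sup>2) < 1}"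

definition unit_sphere :: "nat \<Rightarrow> (nat \<Rightarrow> real) set" where
  "unit_sphere m = {x \<in> topspace (Euclidean_space m). (\<Sum>i<m. (x i)\<^sup>2) = 1}"

text \<open>
  A CW structure on \<open>X\<close>: \<open>E\<close> is the set of open cells, \<open>cdim e\<close> is the dimension of the cell \<open>e\<close> and
  \<open>\<Phi> e\<close> is its characteristic map. The last two clauses are closure finiteness and the weak topology.
\<close>

definition CW_structure ::
  "'a topology \<Rightarrow> 'a set set \<Rightarrow> ('a set \<Rightarrow> nat) \<Rightarrow> ('a set \<Rightarrow> (nat \<Rightarrow> real) \<Rightarrow> 'a) \<Rightarrow> bool"
  where
  "CW_structure X E cdim \<Phi> \<longleftrightarrow>
     Hausdorff_space X \<and>
     \<Union>E = topspace X \<and> disjoint E \<and>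
     (\<forall>e\<in>E.
        continuous_map (subtopology (Euclidean_space (cdim e)) (unit_disc (cdim e))) X (\<Phi> e) \<and>
        homeomorphic_map (subtopology (Euclidean_space (cdim e)) (unit_open_disc (cdim e)))
          (subtopology X e) (\<Phi> e) \<and>
        (\<exists>F\<subseteq>E. finite F \<and> (\<forall>f\<in>F. cdim f < cdim e) \<and> \<Phi> e ` unit_sphere (cdim e) \<subseteq> \<Union>F)) \<and>
     (\<forall>A\<subseteq>topspace X. (\<forall>e\<in>E. closedin X (A \<inter> X closure_of e)) \<longrightarrow> closedin X A)"

end

theory Submission
  imports Defs "HOL-Computational_Algebra.Primes" "HOL-Real_Asymp.Real_Asymp"
begin

text \<open>
  The van der Waerden complex collapses, in the elementary sense of simple homotopy theory, onto a
  subcomplex of small dimension. The realization of a finite complex has the open simplices as cells,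
  so that subcomplex is the required CW complex.

  The collapse comes from discrete Morse theory. Split the nonempty faces \<open>F\<close> of \<open>vdW(n,k)\<close> into
  blocks according to \<open>x = Min F\<close>, \<open>y = Max F\<close> and the greatest common divisor \<open>g\<close> of the differences
  \<open>a - x\<close> for \<open>a \<in> F\<close>. Whether \<open>F\<close> is a face depends only on \<open>(x, y, g)\<close>, so every block that meets
  the complex lies in it; if also \<open>x < y\<close>, then \<open>(y - x) / g \<le> k\<close>. In that case the block consists
  of the sets \<open>{x, y} \<union> A\<close> where \<open>A\<close> is a set of points \<open>x + g i\<close> strictly between \<open>x\<close> and \<open>y\<close> that,
  for each prime \<open>p\<close> dividing \<open>(y - x) / g\<close>, is not contained in the progression \<open>x + g p \<int>\<close>. If there
  are \<open>r\<close> such primes, then \<open>A\<close> has to avoid being contained in any of \<open>r\<close> given sets, and such a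
  family admits an acyclic matching whose unmatched members have at most \<open>r\<close> elements
  (\<open>morse_family_avoiding\<close>). Under inclusion the blocks are partially ordered, so the matchings
  combine (\<open>morse_family_fibers\<close>), and the faces left unmatched have at most \<open>r + 2\<close> vertices.

  An acyclic matching that leaves no face with more than \<open>d\<close> vertices unmatched can be carried out as
  a sequence of elementary collapses that removes all those faces (\<open>morse_family_collapses\<close>), and an
  elementary collapse is a deformation retraction
  (\<open>elementary_collapse_homotopy_equivalent\<close>). What remains has dimension at most \<open>r + 1\<close>.

  Finally, a positive number \<open>m \<le> k\<close> with \<open>r\<close> distinct prime factors is at least \<open>r!\<close>, because the product of
  \<open>r\<close> distinct positive integers is. From \<open>r! \<le> k\<close> and \<open>ln (r!) \<ge> r (ln r - 1)\<close> it follows that \<open>r\<close> is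
  at most \<open>(1 + \<delta>) ln k / ln (ln k)\<close> for large \<open>k\<close>; the additional 1 in the dimension is absorbed by
  \<open>\<epsilon>\<close>.
\<close>

section \<open>Acyclic matchings\<close>

text \<open>
  An acyclic matching, presented by a linear extension: the family is built up from below, each step
  adding on top either an unmatched set with at most \<open>d\<close> elements or a matched pair \<open>s\<close>,
  \<open>insert v s\<close>. That no earlier set contains \<open>s\<close> makes the matching acyclic, and read backwards it
  says that \<open>s\<close> is a free face of \<open>insert v s\<close> at the moment when the pair is removed.
\<close>

inductive morse_family :: "nat \<Rightarrow> 'a set set \<Rightarrow> bool" for d where
  empty: "morse_family d {}"
| critical: "morse_family d C \<Longrightarrow> finite s \<Longrightarrow> card s \<le> d \<Longrightarrow> \<forall>A\<in>C. \<not> s \<subseteq> A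
    \<Longrightarrow> morse_family d (insert s C)"
| pair: "morse_family d C \<Longrightarrow> finite s \<Longrightarrow> v \<notin> s \<Longrightarrow> \<forall>A\<in>C. \<not> s \<subseteq> A
    \<Longrightarrow> morse_family d (insert s (insert (insert v s) C))"

lemma morse_family_mono:
  "morse_family d C \<Longrightarrow> d \<le> d' \<Longrightarrow> morse_family d' C"
  by (induction rule: morse_family.induct)
     (auto intro: morse_family.intros)

lemma morse_family_Un:
  assumes "morse_family d C'" "morse_family d C" "\<forall>B\<in>C'. \<forall>A\<in>C. \<not> B \<subseteq> A"
  shows "morse_family d (C' \<union> C)"
  using assms
proof (induction rule: morse_family.induct)
  case empty
  then show ?case by simp
next
  case (critical C' s)
  then show ?case by (auto intro!: morse_family.critical)
next
  case (pair C' s v)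
  then show ?case by (auto intro!: morse_family.pair)
qed

text \<open>
  The patchwork principle: by monotonicity, no set in a fibre over a larger value is contained in one
  over a smaller value, so the fibres can be stacked in increasing order.
\<close>

lemma morse_family_fibers:
  fixes f :: "'a set \<Rightarrow> 'b::linorder"
  assumes "finite C"
    and "\<And>A B. A \<in> C \<Longrightarrow> B \<in> C \<Longrightarrow> A \<subseteq> B \<Longrightarrow> f A \<le> f B"
    and "\<And>b. morse_family d {A \<in> C. f A = b}"
  shows "morse_family d C"
proof -
  have "finite S \<Longrightarrow> morse_family d {A \<in> C. f A \<in> S}" for S
  proof (induction S rule: finite_linorder_max_induct)
    case empty
    then show ?case by (simp add: morse_family.empty)
  next
    case (insert b S)
    have "{A \<in> C. f A \<in> insert b S} = {A \<in> C. f A = b} \<union> {A \<in> C. f A \<in> S}"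
      by auto
    moreover have "morse_family d ({A \<in> C. f A = b} \<union> {A \<in> C. f A \<in> S})"
      using insert assms(2,3) by (intro morse_family_Un) fastforce+
    ultimately show ?case by simp
  qed
  from this[of "f ` C"] have "morse_family d {A \<in> C. f A \<in> f ` C}"
    using assms(1) by simp
  also have "{A \<in> C. f A \<in> f ` C} = C" by auto
  finally show ?thesis .
qed

text \<open>
  When adding or removing \<open>v\<close> never leaves the family, match each \<open>A\<close> without \<open>v\<close> with \<open>insert v A\<close>.
  A maximal set among those without \<open>v\<close> gives a pair that can be put last.
\<close>

lemma morse_family_toggle:
  assumes "finite C" "\<And>A. A \<in> C \<Longrightarrow> finite A"
    and "\<And>A. A \<in> C \<Longrightarrow> insert v A \<in> C" "\<And>A. A \<in> C \<Longrightarrow> A - {v} \<in> C"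
  shows "morse_family d C"
  using assms
proof (induction "card C" arbitrary: C rule: less_induct)
  case less
  show ?case
  proof (cases "C = {}")
    case True
    then show ?thesis by (simp add: morse_family.empty)
  next
    case False
    then have "(\<lambda>A. A - {v}) ` C \<noteq> {}" by auto
    with less.prems(1) obtain s where s: "s \<in> (\<lambda>A. A - {v}) ` C"
      and max: "\<And>B. B \<in> (\<lambda>A. A - {v}) ` C \<Longrightarrow> s \<subseteq> B \<Longrightarrow> B = s"
      using finite_has_maximal[of "(\<lambda>A. A - {v}) ` C"] by (metis finite_imageI)
    define C' where "C' = C - {s, insert v s}"
    have sC: "s \<in> C" "v \<notin> s" using s less.prems(4) by auto
    then have vC: "insert v s \<in> C" using less.prems(3) by auto
    have "morse_family d C'"
    proof (rule less.hyps)
      show "card C' < card C"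
        unfolding C'_def using sC less.prems(1) by (intro psubset_card_mono) auto
      show "insert v A \<in> C'" if "A \<in> C'" for A
        using that less.prems(3)[of A] sC unfolding C'_def
        by auto
      show "A - {v} \<in> C'" if "A \<in> C'" for A
        using that less.prems(4)[of A] sC unfolding C'_def by auto
    qed (use less.prems in \<open>auto simp: C'_def\<close>)
    moreover have "\<not> s \<subseteq> A" if "A \<in> C'" for A
    proof
      assume "s \<subseteq> A"
      moreover have "A - {v} \<in> (\<lambda>A. A - {v}) ` C" using that by (auto simp: C'_def)
      ultimately have "A - {v} = s" using max[of "A - {v}"] sC by blast
      then show False using that by (auto simp: C'_def)
    qed
    ultimately have "morse_family d (insert s (insert (insert v s) C'))"
      using sC less.prems(2) by (intro morse_family.pair) auto
    also have "insert s (insert (insert v s) C') = C" using sC vC by (auto simp: C'_def)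
    finally show ?thesis .
  qed
qed

lemma morse_family_insert_image:
  assumes "morse_family d C" "\<forall>A\<in>C. v \<notin> A"
  shows "morse_family (Suc d) (insert v ` C)"
  using assms
proof (induction rule: morse_family.induct)
  case empty
  then show ?case by (simp add: morse_family.empty)
next
  case (critical C s)
  then have "morse_family (Suc d) (insert (insert v s) (insert v ` C))"
    by (intro morse_family.critical) auto
  then show ?case by simp
next
  case (pair C s u)
  then have "morse_family (Suc d) (insert (insert v s) (insert (insert u (insert v s)) (insert v ` C)))"
    by (intro morse_family.pair) auto
  then show ?case by (simp add: insert_commute)
qed

text \<open>
  Match by toggling some \<open>v \<in> V\<close> whenever the result still avoids \<open>\<N>\<close>. The sets left over are
  \<open>insert v B\<close> with \<open>B\<close> contained in some \<open>N \<in> \<N>\<close>, and then \<open>v \<notin> N\<close>. Sorting these \<open>B\<close> by the first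
  such \<open>N\<close> in an enumeration yields families of the same kind inside \<open>N - {v}\<close> that have to avoid fewer
  than \<open>card \<N>\<close> sets, so induction applies; the vertex \<open>v\<close> costs one element and \<open>N\<close> pays for it.
\<close>

lemma morse_family_avoiding:
  fixes \<N> :: "'a set set"
  assumes "finite V" "finite \<N>"
  shows "morse_family (card \<N>) {A. A \<subseteq> V \<and> (\<forall>N\<in>\<N>. \<not> A \<subseteq> N)}"
  using assms
proof (induction "card \<N>" arbitrary: V \<N> rule: less_induct)
  case less
  let ?C = "{A. A \<subseteq> V \<and> (\<forall>N\<in>\<N>. \<not> A \<subseteq> N)}"
  show ?case
  proof (cases "V = {}")
    case True
    then have "?C = {} \<or> ?C = insert {} {}" by auto
    moreover have "morse_family (card \<N>) {{}}"
      by (intro morse_family.critical morse_family.empty) auto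
    ultimately show ?thesis
      by (elim disjE; simp only: morse_family.empty)
  next
    case False
    then obtain v where v: "v \<in> V" by auto
    \<comment> \<open>\<open>T\<close> is matched by toggling \<open>v\<close>; \<open>U S\<close> collects the remaining sets, without \<open>v\<close>, that lie in
      a member of \<open>S\<close>. Sets in \<open>Q\<close> contain \<open>v\<close>, so for them avoidance is unaffected by removing \<open>v\<close>.\<close>
    define P where "P = {N \<in> \<N>. v \<notin> N}"
    define Q where "Q = {N \<in> \<N>. v \<in> N}"
    define T where "T = {A. A \<subseteq> V \<and> (\<forall>N\<in>\<N>. \<not> A - {v} \<subseteq> N)}"
    define U where "U S = {B. B \<subseteq> V - {v} \<and> (\<exists>N\<in>S. B \<subseteq> N) \<and> (\<forall>N\<in>Q. \<not> B \<subseteq> N)}" for S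
    have PQ: "\<N> = P \<union> Q" "P \<inter> Q = {}" "finite P" "finite Q"
      using less.prems by (auto simp: P_def Q_def)
    have T: "morse_family (card \<N>) T"
    proof (rule morse_family_toggle[where v = v])
      show "finite T" using less.prems by (simp add: T_def)
      show "finite A" if "A \<in> T" for A
        using that less.prems by (auto simp: T_def intro: finite_subset)
      show "insert v A \<in> T" "A - {v} \<in> T" if "A \<in> T" for A
        using that v unfolding T_def by auto
    qed
    have U: "morse_family (card \<N> - 1) (U S)" if "finite S" "S \<subseteq> P" for S
      using that
    proof (induction S rule: finite_induct)
      case empty
      then show ?case by (simp add: U_def morse_family.empty)
    next
      case (insert N S)
      \<comment> \<open>Members of \<open>U (insert N S)\<close> that are not in \<open>U S\<close> lie in \<open>N\<close> and avoid \<open>S\<close> as well as \<open>Q\<close>.\<close>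
      let ?W = "{B. B \<subseteq> N \<inter> (V - {v}) \<and> (\<forall>N\<in>S \<union> Q. \<not> B \<subseteq> N)}"
      have "card (S \<union> Q) < card \<N>"
        using insert PQ less.prems by (intro psubset_card_mono) auto
      moreover have "finite (N \<inter> (V - {v}))" "finite (S \<union> Q)"
        using less.prems insert PQ by auto
      ultimately have "morse_family (card (S \<union> Q)) ?W" by (rule less.hyps)
      then have W: "morse_family (card \<N> - 1) ?W"
        by (rule morse_family_mono) (use \<open>card (S \<union> Q) < card \<N>\<close> in simp)
      have eq: "U (insert N S) = ?W \<union> U S" unfolding U_def by blast
      have sep: "\<forall>B\<in>?W. \<forall>A\<in>U S. \<not> B \<subseteq> A" unfolding U_def by blast
      have "morse_family (card \<N> - 1) (U S)" using insert.IH insert.prems by simp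
      with W show ?case unfolding eq using sep by (rule morse_family_Un)
    qed
    have "morse_family (card \<N>) (insert v ` U P)"
    proof (cases "P = {}")
      case True
      then show ?thesis by (simp add: U_def morse_family.empty)
    next
      case False
      then have "Suc (card \<N> - 1) = card \<N>" using PQ by (auto simp: card_gt_0_iff)
      moreover have "morse_family (Suc (card \<N> - 1)) (insert v ` U P)"
        using PQ by (intro morse_family_insert_image U) (auto simp: U_def)
      ultimately show ?thesis by simp
    qed
    moreover have "\<forall>B\<in>T. \<forall>A\<in>insert v ` U P. \<not> B \<subseteq> A"
    proof (intro ballI notI)
      fix B A assume "B \<in> T" "A \<in> insert v ` U P" "B \<subseteq> A"
      then obtain A' N where "N \<in> \<N>" "A' \<subseteq> N" "A = insert v A'" by (auto simp: U_def P_def)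
      then have "B - {v} \<subseteq> N" using \<open>B \<subseteq> A\<close> by auto
      then show False using \<open>B \<in> T\<close> \<open>N \<in> \<N>\<close> by (auto simp: T_def)
    qed
    ultimately have "morse_family (card \<N>) (T \<union> insert v ` U P)"
      using T by (intro morse_family_Un) auto
    also have "T \<union> insert v ` U P = ?C"
    proof (intro equalityI subsetI)
      fix A assume "A \<in> T \<union> insert v ` U P"
      then show "A \<in> ?C" using v by (auto simp: T_def U_def P_def Q_def)
    next
      fix A assume A: "A \<in> ?C"
      show "A \<in> T \<union> insert v ` U P"
      proof (cases "A \<in> T")
        case False
        then obtain N where N: "N \<in> \<N>" "A - {v} \<subseteq> N" using A by (auto simp: T_def)
        then have "v \<in> A" "v \<notin> N" using A by auto
        then have "A - {v} \<in> U P" using A N by (auto simp: U_def P_def Q_def)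
        then show ?thesis using \<open>v \<in> A\<close> by (auto intro!: image_eqI[where x = "A - {v}"])
      qed auto
    qed
    finally show ?thesis .
  qed
qed

section \<open>Collapsing along an acyclic matching\<close>

definition simplicial_complex :: "'a set set \<Rightarrow> bool" where
  "simplicial_complex K \<longleftrightarrow> (\<forall>A\<in>K. finite A \<and> (\<forall>B\<subseteq>A. B \<in> K))"

lemma simplicial_complex_subset:
  assumes "simplicial_complex K" "C \<subseteq> K" "\<And>A B. A \<in> C \<Longrightarrow> B \<in> K - C \<Longrightarrow> \<not> B \<subseteq> A"
  shows "simplicial_complex C"
  using assms unfolding simplicial_complex_def by (meson Diff_iff subsetD)

text \<open>
  Elementary collapses that remove a free face \<open>s\<close> with at least \<open>d\<close> elements together with the unique
  larger face. The bound \<open>d\<close> makes collapsing compatible with adding back faces of at most \<open>d\<close>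
  elements.
\<close>

inductive collapses :: "nat \<Rightarrow> 'a set set \<Rightarrow> 'a set set \<Rightarrow> bool" for d where
  refl: "collapses d K K"
| step: "finite s \<Longrightarrow> d \<le> card s \<Longrightarrow> v \<notin> s \<Longrightarrow> s \<in> K \<Longrightarrow> insert v s \<in> K
    \<Longrightarrow> \<forall>A\<in>K. s \<subseteq> A \<longrightarrow> A = s \<or> A = insert v s
    \<Longrightarrow> collapses d (K - {s, insert v s}) L \<Longrightarrow> collapses d K L"

lemma collapses_subset: "collapses d K L \<Longrightarrow> L \<subseteq> K"
  by (induction rule: collapses.induct) auto

lemma collapses_keeps_small:
  "collapses d K L \<Longrightarrow> A \<in> K \<Longrightarrow> card A < d \<Longrightarrow> A \<in> L"
proof (induction rule: collapses.induct)
  case (step s v K L)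
  then have "A \<noteq> s" "A \<noteq> insert v s" by auto
  with step show ?case by auto
qed auto

text \<open>
  A set \<open>S\<close> with at most \<open>d\<close> elements does not contain any of the free faces that are removed, since those
  have at least \<open>d\<close> elements and differ from \<open>S\<close>. So they are still free when \<open>S\<close> is present.
\<close>

lemma collapses_insert:
  "collapses d K L \<Longrightarrow> finite S \<Longrightarrow> card S \<le> d \<Longrightarrow> S \<notin> K
    \<Longrightarrow> collapses d (insert S K) (insert S L)"
proof (induction rule: collapses.induct)
  case (refl K)
  then show ?case by (auto intro: collapses.refl)
next
  case (step s v K L)
  have ns: "\<not> s \<subseteq> S"
    using step.hyps step.prems card_seteq[of S s] by auto
  have "insert S K - {s, insert v s} = insert S (K - {s, insert v s})"
    using step.hyps step.prems by auto
  then have "collapses d (insert S K - {s, insert v s}) (insert S L)"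
    using step.IH step.prems by simp
  then show ?case
    by (rule collapses.step[rotated 6]) (use step.hyps ns in auto)
qed

lemma collapses_extend:
  assumes "collapses d C L" "simplicial_complex L" "\<forall>A\<in>L. card A \<le> d"
    and "simplicial_complex (insert s C)" "card s \<le> d" "s \<notin> C"
  shows "collapses d (insert s C) (insert s L) \<and> simplicial_complex (insert s L)
    \<and> (\<forall>A\<in>insert s L. card A \<le> d)"
proof (intro conjI)
  have fin: "finite s" using assms(4) by (auto simp: simplicial_complex_def)
  show "collapses d (insert s C) (insert s L)"
    using assms fin by (intro collapses_insert) auto
  have "B \<in> insert s L" if "B \<subseteq> s" for B
  proof (cases "B = s")
    case False
    then have "card B < d" using that fin assms(5) psubset_card_mono[of s B] by fastforce
    moreover have "B \<in> C" using that False assms(4) by (auto simp: simplicial_complex_def)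
    ultimately show ?thesis using collapses_keeps_small[OF assms(1)] by simp
  qed auto
  then show "simplicial_complex (insert s L)"
    using assms(2) fin unfolding simplicial_complex_def by auto
  show "\<forall>A\<in>insert s L. card A \<le> d" using assms(3,5) by simp
qed

text \<open>
  Unmatched sets, and pairs whose larger set has at most \<open>d\<close> elements, are kept on both sides of the
  collapse of what is below them; the other pairs are collapsed in the order opposite to the one in
  which they were added.
\<close>

lemma morse_family_collapses:
  assumes "morse_family d K" "simplicial_complex K"
  shows "\<exists>L. collapses d K L \<and> simplicial_complex L \<and> (\<forall>A\<in>L. card A \<le> d)"
  using assms
proof (induction rule: morse_family.induct)
  case empty
  show ?case
    by (intro exI[of _ "{}"]) (simp add: collapses.refl simplicial_complex_def)
next
  case (critical C s)
  have "simplicial_complex C"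
    by (rule simplicial_complex_subset[OF critical.prems]) (use critical.hyps in auto)
  then obtain L where L: "collapses d C L" "simplicial_complex L" "\<forall>A\<in>L. card A \<le> d"
    using critical.IH by blast
  have "s \<notin> C" using critical.hyps by blast
  then show ?case
    using collapses_extend[OF L critical.prems] critical.hyps by blast
next
  case (pair C s v)
  have notin: "s \<notin> C" "insert v s \<notin> C" "insert v s \<noteq> s" using pair.hyps by blast+
  have C: "simplicial_complex C"
    by (rule simplicial_complex_subset[OF pair.prems]) (use pair.hyps in auto)
  then obtain L where L: "collapses d C L" "simplicial_complex L" "\<forall>A\<in>L. card A \<le> d"
    using pair.IH by blast
  show ?case
  proof (cases "d \<le> card s")
    case True
    have "insert s (insert (insert v s) C) - {s, insert v s} = C" using notin by auto
    then have "collapses d (insert s (insert (insert v s) C) - {s, insert v s}) L"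
      using L by simp
    then have "collapses d (insert s (insert (insert v s) C)) L"
      by (rule collapses.step[rotated 6]) (use pair.hyps True in auto)
    then show ?thesis using L by blast
  next
    case False
    have sC: "simplicial_complex (insert s C)"
      by (rule simplicial_complex_subset[OF pair.prems]) (use pair.hyps in auto)
    have L': "collapses d (insert s C) (insert s L)" "simplicial_complex (insert s L)"
      "\<forall>A\<in>insert s L. card A \<le> d"
      using collapses_extend[OF L sC] False notin by auto
    have "simplicial_complex (insert (insert v s) (insert s C))"
      using pair.prems by (simp add: insert_commute)
    moreover have "card (insert v s) \<le> d" using pair.hyps False by simp
    ultimately have "collapses d (insert (insert v s) (insert s C)) (insert (insert v s) (insert s L))
      \<and> simplicial_complex (insert (insert v s) (insert s L))
      \<and> (\<forall>A\<in>insert (insert v s) (insert s L). card A \<le> d)"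
      using collapses_extend[OF L'] notin by auto
    then show ?thesis by (subst insert_commute) blast
  qed
qed

section \<open>Elementary collapses of realizations\<close>

definition realization_points :: "'v set set \<Rightarrow> ('v \<Rightarrow> real) set" where
  "realization_points K = {x. (\<forall>v. 0 \<le> x v) \<and> {v. x v \<noteq> 0} \<in> K \<and> (\<Sum>v | x v \<noteq> 0. x v) = 1}"

lemma geometric_realization_eq: "geometric_realization K = top_of_set (realization_points K)"
  by (simp add: geometric_realization_def realization_points_def euclidean_product_topology)

lemma sum_support:
  fixes x :: "'v \<Rightarrow> real"
  assumes "finite A" "{v. x v \<noteq> 0} \<subseteq> A"
  shows "(\<Sum>v | x v \<noteq> 0. x v) = sum x A"
  using assms by (intro sum.mono_neutral_left) auto

lemma continuous_on_Min:
  fixes f :: "'i \<Rightarrow> 'a::topological_space \<Rightarrow> real"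
  assumes "finite I" "I \<noteq> {}" "\<And>i. i \<in> I \<Longrightarrow> continuous_on S (f i)"
  shows "continuous_on S (\<lambda>x. Min ((\<lambda>i. f i x) ` I))"
  using assms
proof (induction I rule: finite_ne_induct)
  case (singleton i)
  then show ?case by simp
next
  case (insert i I)
  then have "continuous_on S (\<lambda>x. min (f i x) (Min ((\<lambda>i. f i x) ` I)))"
    by (intro continuous_intros) auto
  then show ?case using insert by simp
qed

text \<open>
  Let \<open>m x\<close> be the least barycentric coordinate of \<open>x\<close> on \<open>s\<close>. Moving the amount \<open>t * m x\<close> from each
  vertex of \<open>s\<close> to \<open>v\<close> keeps the sum of the coordinates. It fixes every point with \<open>m x = 0\<close>, in particular
  the points of the smaller complex; the other points lie in the simplex \<open>insert v s\<close> because \<open>s\<close> is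
  free, so the motion stays in the complex, and at \<open>t = 1\<close> some coordinate on \<open>s\<close> has become 0. This is a
  deformation retraction.
\<close>

lemma elementary_collapse_homotopy_equivalent:
  fixes K :: "'v set set"
  assumes K: "simplicial_complex K" and s: "s \<in> K" "s \<noteq> {}" and v: "v \<notin> s" "insert v s \<in> K"
    and free: "\<forall>A\<in>K. s \<subseteq> A \<longrightarrow> A = s \<or> A = insert v s"
  shows "geometric_realization K homotopy_equivalent_space
    geometric_realization (K - {s, insert v s})"
proof -
  let ?R = "realization_points K" and ?R' = "realization_points (K - {s, insert v s})"
  have fin: "finite s" using K s by (auto simp: simplicial_complex_def)
  define m :: "('v \<Rightarrow> real) \<Rightarrow> real" where "m x = Min (x ` s)" for x
  define push :: "real \<Rightarrow> ('v \<Rightarrow> real) \<Rightarrow> 'v \<Rightarrow> real" where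
    "push t x = (\<lambda>u. if u \<in> s then x u - t * m x
                     else if u = v then x u + t * (card s * m x) else x u)" for t x
  have m_le: "m x \<le> x u" if "u \<in> s" for x u
    using fin that by (simp add: m_def)
  have m_attained: "\<exists>u\<in>s. x u = m x" for x
  proof -
    have "Min (x ` s) \<in> x ` s" using fin s by (intro Min_in) auto
    then show ?thesis by (auto simp: m_def)
  qed
  have push_trivial: "push t x = x" if "m x = 0" for t x
    using that by (auto simp: push_def)
  have m_0: "push 0 x = x" for x by (auto simp: push_def)
  have m_nonneg: "0 \<le> m x" if "x \<in> ?R" for x
    using m_attained[of x] that by (auto simp: realization_points_def) (metis)
  have m_pos: "{u. x u \<noteq> 0} = s \<or> {u. x u \<noteq> 0} = insert v s" if "x \<in> ?R" "m x \<noteq> 0" for x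
  proof -
    have "s \<subseteq> {u. x u \<noteq> 0}" using m_le[of _ x] m_nonneg[OF that(1)] that(2) by force
    then show ?thesis using free that(1) by (auto simp: realization_points_def)
  qed
  have push_in: "push t x \<in> ?R" if "x \<in> ?R" "0 \<le> t" "t \<le> 1" for t x
  proof (cases "m x = 0")
    case True
    then show ?thesis using push_trivial that by simp
  next
    case False
    have supp: "{u. x u \<noteq> 0} \<subseteq> insert v s" using m_pos[OF that(1) False] by auto
    then have supp': "{u. push t x u \<noteq> 0} \<subseteq> insert v s" by (auto simp: push_def)
    have "0 \<le> push t x u" for u
    proof -
      have "t * m x \<le> m x" using m_nonneg[OF that(1)] that(2,3) by (simp add: mult_left_le_one_le)
      then show ?thesis
        using m_le[of u x] m_nonneg[OF that(1)] that by (auto simp: push_def realization_points_def)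
    qed
    moreover have "{u. push t x u \<noteq> 0} \<in> K"
      using supp' v K by (auto simp: simplicial_complex_def)
    moreover have "(\<Sum>u | push t x u \<noteq> 0. push t x u) = 1"
    proof -
      have "(\<Sum>u | push t x u \<noteq> 0. push t x u) = sum (push t x) (insert v s)"
        using supp' fin by (intro sum_support) auto
      also have "\<dots> = x v + t * (card s * m x) + (\<Sum>u\<in>s. x u - t * m x)"
        using v fin by (simp add: push_def)
      also have "\<dots> = sum x (insert v s)" using v fin by (simp add: sum_subtractf)
      also have "\<dots> = (\<Sum>u | x u \<noteq> 0. x u)"
        using supp fin by (intro sum_support[symmetric]) auto
      finally show ?thesis using that(1) by (simp add: realization_points_def)
    qed
    ultimately show ?thesis by (simp add: realization_points_def)
  qed
  have push_1: "push 1 x \<in> ?R'" if "x \<in> ?R" for x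
  proof -
    obtain u where "u \<in> s" "x u = m x" using m_attained by blast
    then have "u \<in> s" "push 1 x u = 0" by (auto simp: push_def)
    then have "{u. push 1 x u \<noteq> 0} \<noteq> s" "{u. push 1 x u \<noteq> 0} \<noteq> insert v s" by auto
    then show ?thesis using push_in[OF that, of 1] by (simp add: realization_points_def)
  qed
  have push_fixed: "push 1 x = x" if "x \<in> ?R'" for x
  proof (rule push_trivial, rule ccontr)
    assume "m x \<noteq> 0"
    then show False using that m_pos[of x] by (auto simp: realization_points_def)
  qed
  have coord: "continuous_on S (\<lambda>p. snd p i :: real)" for S :: "(real \<times> ('v \<Rightarrow> real)) set" and i
    by (rule continuous_on_product_then_coordinatewise[OF continuous_on_snd]) (rule continuous_on_id)
  have cont: "continuous_on S (\<lambda>p. push (fst p) (snd p))" for S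
  proof (rule continuous_on_coordinatewise_then_product)
    fix i
    have "continuous_on S (\<lambda>p. m (snd p))"
      unfolding m_def using fin s coord by (intro continuous_on_Min) auto
    then show "continuous_on S (\<lambda>p. push (fst p) (snd p) i)"
      unfolding push_def using coord
      by (cases "i \<in> s"; cases "i = v") (auto intro!: continuous_intros)
  qed
  have push_cont: "continuous_on S (push 1)" for S
    using continuous_on_compose2[OF cont[of UNIV], of S "\<lambda>x. (1, x)"]
    by (simp add: continuous_on_Pair)
  have "homotopic_with (\<lambda>x. True) (top_of_set ?R) (top_of_set ?R) id (push 1)"
  proof (subst homotopic_with)
    show "\<exists>h. continuous_map (prod_topology (top_of_set {0..1::real}) (top_of_set ?R)) (top_of_set ?R) h \<and>
        (\<forall>x\<in>topspace (top_of_set ?R). h (0, x) = id x) \<and>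
        (\<forall>x\<in>topspace (top_of_set ?R). h (1, x) = push 1 x) \<and> (\<forall>t\<in>{0..1::real}. True)"
      using cont push_in m_0
      by (intro exI[of _ "\<lambda>p. push (fst p) (snd p)"])
         (auto simp: prod_topology_subtopology_eu)
  qed auto
  then have "homotopic_with (\<lambda>x. True) (top_of_set ?R) (top_of_set ?R) (push 1) id"
    by (rule homotopic_with_symD)
  moreover have "retraction_maps (top_of_set ?R) (top_of_set ?R') (push 1) id"
    unfolding retraction_maps_def
    using push_cont push_1 push_fixed by (auto simp: realization_points_def)
  ultimately show ?thesis
    unfolding geometric_realization_eq by (rule deformation_retract_imp_homotopy_equivalent_space)
qed

lemma collapses_homotopy_equivalent:
  assumes "collapses d K L" "simplicial_complex K" "0 < d"
  shows "geometric_realization K homotopy_equivalent_space geometric_realization L"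
  using assms
proof (induction rule: collapses.induct)
  case (refl K)
  then show ?case by (simp add: homotopy_equivalent_space_refl)
next
  case (step s v K L)
  have "simplicial_complex (K - {s, insert v s})"
    by (rule simplicial_complex_subset[OF step.prems(1)]) (use step.hyps in auto)
  then have L: "geometric_realization (K - {s, insert v s}) homotopy_equivalent_space geometric_realization L"
    using step.IH step.prems by blast
  have "geometric_realization K homotopy_equivalent_space
      geometric_realization (K - {s, insert v s})"
    by (rule elementary_collapse_homotopy_equivalent) (use step.prems step.hyps in auto)
  then show ?case using L by (rule homotopy_eqv_trans)
qed

section \<open>A homeomorphism from the disc to the simplex\<close>

text \<open>
  The gauge of the standard simplex centred at its barycentre, on vectors \<open>w\<close> with coordinate sum 0: the
  point with coordinates \<open>1 / (m + 1) + w i\<close> lies in the simplex if and only if \<open>depth m w \<le> 1\<close>, and in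
  its interior if and only if \<open>depth m w < 1\<close>.
\<close>

definition depth :: "nat \<Rightarrow> (nat \<Rightarrow> real) \<Rightarrow> real" where
  "depth m w = - (real (Suc m) * Min (w ` {..m}))"

text \<open>
  The linear isomorphism from \<open>\<real>\<^sup>m\<close> onto the vectors in \<open>\<real>\<^bsup>m+1\<^esup>\<close> with coordinate sum 0.
\<close>

definition balanced :: "nat \<Rightarrow> (nat \<Rightarrow> real) \<Rightarrow> nat \<Rightarrow> real" where
  "balanced m y i = (if i < m then y i else - (\<Sum>j<m. y j))"

definition disc_norm :: "nat \<Rightarrow> (nat \<Rightarrow> real) \<Rightarrow> real" where
  "disc_norm m y = sqrt (\<Sum>i<m. (y i)\<^sup>2)"

text \<open>
  The radial map that carries the disc to the simplex, relative to the barycentre: the image of \<open>y\<close> lies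
  in the direction of \<open>balanced m y\<close> and its gauge equals the norm of \<open>y\<close>. At \<open>y = 0\<close> the convention
  \<open>0 / 0 = 0\<close> gives the right value.
\<close>

definition displacement :: "nat \<Rightarrow> (nat \<Rightarrow> real) \<Rightarrow> nat \<Rightarrow> real" where
  "displacement m y i = disc_norm m y / depth m (balanced m y) * balanced m y i"

lemma depth_scale:
  assumes "0 \<le> c"
  shows "depth m (\<lambda>i. c * w i) = c * depth m w"
proof -
  have "Min ((\<lambda>i. c * w i) ` {..m}) = Min ((\<lambda>t. c * t) ` w ` {..m})"
    by (simp add: image_image)
  also have "\<dots> = c * Min (w ` {..m})"
    using assms by (intro mono_Min_commute[symmetric]) (auto simp: mono_def mult_left_mono)
  finally show ?thesis by (simp add: depth_def)
qed

lemma depth_cong: "(\<And>i. i \<le> m \<Longrightarrow> w i = w' i) \<Longrightarrow> depth m w = depth m w'"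
  by (simp add: depth_def)

lemma depth_lower:
  assumes "i \<le> m"
  shows "- w i \<le> depth m w / real (Suc m)"
  using assms by (simp add: depth_def del: of_nat_Suc)

lemma depth_attained: "\<exists>i\<le>m. - w i = depth m w / real (Suc m)"
proof -
  have "Min (w ` {..m}) \<in> w ` {..m}" by (intro Min_in) auto
  then obtain i where "Min (w ` {..m}) = w i" "i \<in> {..m}" by (rule imageE)
  then show ?thesis by (intro exI[of _ i]) (simp add: depth_def del: of_nat_Suc)
qed

text \<open>
  With coordinate sum 0, the numbers \<open>w j + M\<close>, where \<open>- M\<close> is the minimum of \<open>w\<close>, are nonnegative and add up
  to \<open>depth m w\<close>, so the gauge dominates each coordinate.
\<close>

lemma depth_bound:
  assumes "(\<Sum>i\<le>m. w i) = 0" "i \<le> m"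
  shows "\<bar>w i\<bar> \<le> depth m w"
proof -
  define M where "M = - Min (w ` {..m})"
  have dM: "depth m w = real (Suc m) * M" unfolding depth_def M_def by (simp only: mult_minus_right)
  have M: "0 \<le> w j + M" if "j \<le> m" for j
  proof -
    have "Min (w ` {..m}) \<le> w j" using that by (intro Min_le) auto
    then show ?thesis unfolding M_def by linarith
  qed
  have total: "(\<Sum>j\<le>m. w j + M) = depth m w"
    using assms(1) by (simp add: sum.distrib dM)
  have "w i + M \<le> depth m w"
    unfolding total[symmetric] using assms(2) M by (intro member_le_sum) auto
  moreover have nonneg: "0 \<le> depth m w"
    unfolding total[symmetric] using M by (intro sum_nonneg) auto
  moreover have "0 \<le> M" using nonneg by (simp add: dM zero_le_mult_iff)
  moreover have "depth m w = M + m * M" by (simp add: dM algebra_simps)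
  moreover have "0 \<le> m * M" using \<open>0 \<le> M\<close> by simp
  ultimately show ?thesis using M[OF assms(2)] by linarith
qed

lemma sum_balanced: "(\<Sum>i\<le>m. balanced m y i) = 0"
proof -
  have "(\<Sum>i\<le>m. balanced m y i) = (\<Sum>i<m. balanced m y i) + balanced m y m"
    by (metis lessThan_Suc_atMost sum.lessThan_Suc)
  then show ?thesis by (simp add: balanced_def)
qed

lemma disc_norm_nonneg: "0 \<le> disc_norm m y"
  by (simp add: disc_norm_def sum_nonneg)

lemma disc_norm_eq_0_iff: "disc_norm m y = 0 \<longleftrightarrow> (\<forall>i<m. y i = 0)"
  by (auto simp: disc_norm_def sum_nonneg_eq_0_iff)

lemma disc_norm_scale:
  assumes "0 \<le> c" "\<And>i. i < m \<Longrightarrow> y i = c * w i"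
  shows "disc_norm m y = c * disc_norm m w"
proof -
  have "(\<Sum>i<m. (y i)\<^sup>2) = c\<^sup>2 * (\<Sum>i<m. (w i)\<^sup>2)"
    using assms(2) by (simp add: power_mult_distrib sum_distrib_left)
  then show ?thesis using assms(1) by (simp add: disc_norm_def real_sqrt_mult)
qed

lemma depth_balanced_pos:
  assumes "disc_norm m y \<noteq> 0"
  shows "0 < depth m (balanced m y)"
proof -
  obtain i where "i < m" "y i \<noteq> 0" using assms by (auto simp: disc_norm_eq_0_iff)
  then have "0 < \<bar>balanced m y i\<bar>" by (simp add: balanced_def)
  also have "\<dots> \<le> depth m (balanced m y)"
    using \<open>i < m\<close> by (intro depth_bound sum_balanced) auto
  finally show ?thesis .
qed

lemma sum_displacement: "(\<Sum>i\<le>m. displacement m y i) = 0"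
  unfolding displacement_def sum_distrib_left[symmetric] by (simp add: sum_balanced)

lemma depth_displacement: "depth m (displacement m y) = disc_norm m y"
proof -
  have nn: "0 \<le> disc_norm m y / depth m (balanced m y)"
    using disc_norm_nonneg[of m y] depth_balanced_pos[of m y] by (cases "disc_norm m y = 0") auto
  have "displacement m y = (\<lambda>i. disc_norm m y / depth m (balanced m y) * balanced m y i)"
    by (simp add: displacement_def fun_eq_iff)
  then have "depth m (displacement m y)
      = disc_norm m y / depth m (balanced m y) * depth m (balanced m y)"
    using depth_scale[OF nn] by simp
  then show ?thesis using depth_balanced_pos[of m y] by (cases "disc_norm m y = 0") auto
qed

lemma continuous_on_coord: "continuous_on S (\<lambda>x::'i \<Rightarrow> real. x i)"
  by (rule continuous_on_product_then_coordinatewise) (rule continuous_on_id)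

text \<open>
  Away from the zeros of the norm this is a quotient of continuous functions with nonzero denominator.
  At a zero, the displacement is bounded by its gauge, which is the norm and tends to 0.
\<close>

lemma continuous_on_displacement:
  assumes "i \<le> m"
  shows "continuous_on UNIV (\<lambda>y. displacement m y i)"
proof -
  have N: "continuous_on UNIV (disc_norm m)"
    unfolding disc_norm_def by (intro continuous_intros continuous_on_coord)
  have B: "continuous_on UNIV (\<lambda>y. balanced m y j)" for j
    unfolding balanced_def by (cases "j < m") (auto intro!: continuous_intros continuous_on_coord)
  have D: "continuous_on UNIV (\<lambda>y. depth m (balanced m y))"
    unfolding depth_def using B by (auto intro!: continuous_intros continuous_on_Min)
  have "isCont (\<lambda>y. displacement m y i) y" for y
  proof (cases "disc_norm m y = 0")
    case False
    then have "depth m (balanced m y) \<noteq> 0" using depth_balanced_pos by (metis less_irrefl)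
    then show ?thesis unfolding displacement_def
      using N B D by (intro continuous_intros) (auto simp: continuous_on_eq_continuous_at)
  next
    case True
    have to0: "(disc_norm m \<longlongrightarrow> disc_norm m y) (at y)"
      using N by (auto simp: continuous_on_eq_continuous_at isCont_def)
    have "norm (displacement m z i) \<le> disc_norm m z" for z
      using depth_bound[OF sum_displacement assms] depth_displacement by (metis real_norm_def)
    then have "\<forall>\<^sub>F z in at y. norm (displacement m z i) \<le> disc_norm m z" by simp
    then have "((\<lambda>z. displacement m z i) \<longlongrightarrow> 0) (at y)"
      using to0 unfolding True by (rule Lim_null_comparison)
    then show ?thesis using True by (simp add: isCont_def displacement_def)
  qed
  then show ?thesis by (simp add: continuous_on_eq_continuous_at)
qed

text \<open>
  The norm of \<open>y\<close> is recovered as a gauge, and then \<open>y\<close> and \<open>y'\<close> are positive multiples of each other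
  with the same norm.
\<close>

lemma displacement_inj:
  assumes "\<And>i. i \<le> m \<Longrightarrow> displacement m y i = displacement m y' i" "i < m"
  shows "y i = y' i"
proof -
  have N: "disc_norm m y = disc_norm m y'"
    using depth_cong[of m "displacement m y" "displacement m y'"] assms(1)
    by (simp add: depth_displacement)
  show ?thesis
  proof (cases "disc_norm m y = 0")
    case True
    then show ?thesis
      using N assms(2) disc_norm_eq_0_iff[of m y] disc_norm_eq_0_iff[of m y'] by simp
  next
    case False
    define D D' where "D = depth m (balanced m y)" and "D' = depth m (balanced m y')"
    have D: "0 < D" "0 < D'"
      using depth_balanced_pos False N by (simp_all add: D_def D'_def)
    have eq: "y j = D / D' * y' j" if "j < m" for j
      using assms(1)[of j] that False D
      by (simp add: displacement_def N[symmetric] balanced_def D_def[symmetric]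
          D'_def[symmetric] field_simps)
    have "disc_norm m y = D / D' * disc_norm m y'"
      using D eq by (intro disc_norm_scale) auto
    then have "D / D' * disc_norm m y' = 1 * disc_norm m y'" using N by simp
    moreover have "disc_norm m y' \<noteq> 0" using N False by simp
    ultimately have "D / D' = 1" by (metis mult_right_cancel)
    then show ?thesis using eq[OF assms(2)] by simp
  qed
qed

lemma displacement_surj:
  assumes "(\<Sum>i\<le>m. w i) = 0"
  shows "\<exists>y\<in>topspace (Euclidean_space m). \<forall>i\<le>m. displacement m y i = w i"
proof (cases "disc_norm m w = 0")
  case True
  have "(\<Sum>i\<le>m. w i) = (\<Sum>i<m. w i) + w m"
    by (metis lessThan_Suc_atMost sum.lessThan_Suc)
  then have "w i = 0" if "i \<le> m" for i
    using assms True that by (cases "i = m") (auto simp: disc_norm_eq_0_iff)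
  moreover have "disc_norm m (\<lambda>_. 0) = 0" by (simp add: disc_norm_eq_0_iff)
  ultimately show ?thesis
    by (intro bexI[of _ "\<lambda>_. 0"]) (auto simp: displacement_def topspace_Euclidean_space)
next
  case False
  then obtain j where j: "j < m" "w j \<noteq> 0" by (auto simp: disc_norm_eq_0_iff)
  then have dpos: "0 < depth m w"
    using depth_bound[OF assms, of j] by auto
  have npos: "0 < disc_norm m w" using False disc_norm_nonneg[of m w] by linarith
  \<comment> \<open>The rescaling of \<open>w\<close> whose norm is the gauge of \<open>w\<close>.\<close>
  define c where "c = depth m w / disc_norm m w"
  have c: "0 < c" using dpos npos by (simp add: c_def)
  define y where "y = (\<lambda>i. if i < m then c * w i else 0)"
  have wm: "w m = - (\<Sum>i<m. w i)"
    using assms by (metis add.commute add_eq_0_iff lessThan_Suc_atMost sum.lessThan_Suc)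
  have bal: "balanced m y i = c * w i" if "i \<le> m" for i
    using that wm by (auto simp: balanced_def y_def sum_distrib_left[symmetric] dest: le_neq_implies_less)
  have "depth m (balanced m y) = depth m (\<lambda>i. c * w i)" by (intro depth_cong bal)
  then have dep: "depth m (balanced m y) = c * depth m w" using c depth_scale[of c m w] by simp
  have "disc_norm m y = c * disc_norm m w" using c by (intro disc_norm_scale) (auto simp: y_def)
  then have nor: "disc_norm m y = depth m w" using npos by (simp add: c_def)
  have "displacement m y i = w i" if "i \<le> m" for i
    using c dpos that by (simp add: displacement_def dep nor bal)
  moreover have "y \<in> topspace (Euclidean_space m)" by (simp add: y_def topspace_Euclidean_space)
  ultimately show ?thesis by blast
qed

definition open_cell :: "'v set \<Rightarrow> ('v \<Rightarrow> real) set" where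
  "open_cell \<sigma> = {x. (\<forall>v. 0 \<le> x v) \<and> {v. x v \<noteq> 0} = \<sigma> \<and> sum x \<sigma> = 1}"

lemma unit_disc_eq:
  "unit_disc m = {y \<in> topspace (Euclidean_space m). disc_norm m y \<le> 1}"
  "unit_open_disc m = {y \<in> topspace (Euclidean_space m). disc_norm m y < 1}"
  "unit_sphere m = {y \<in> topspace (Euclidean_space m). disc_norm m y = 1}"
  by (auto simp: unit_disc_def unit_open_disc_def unit_sphere_def disc_norm_def)

definition characteristic_map :: "'v set \<Rightarrow> ((nat \<Rightarrow> real) \<Rightarrow> 'v \<Rightarrow> real) \<Rightarrow> bool" where
  "characteristic_map \<sigma> \<Phi> \<longleftrightarrow>
     continuous_on UNIV \<Phi> \<and> inj_on \<Phi> (unit_disc (card \<sigma> - 1)) \<and>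
     \<Phi> ` unit_open_disc (card \<sigma> - 1) = open_cell \<sigma> \<and>
     \<Phi> ` unit_disc (card \<sigma> - 1) \<subseteq> (\<Union>\<tau>\<in>Pow \<sigma> - {{}}. open_cell \<tau>) \<and>
     \<Phi> ` unit_sphere (card \<sigma> - 1) \<subseteq> (\<Union>\<tau>\<in>Pow \<sigma> - {{}, \<sigma>}. open_cell \<tau>)"

text \<open>
  The radial map of the standard simplex, transported to the vertex set \<open>\<sigma>\<close> by an enumeration. The
  smallest barycentric coordinate of the image of \<open>y\<close> is \<open>(1 - disc_norm m y) / (m + 1)\<close>, so the open disc
  goes to the open simplex and the sphere to the proper faces.
\<close>

lemma characteristic_map_exists:
  fixes \<sigma> :: "'v set"
  assumes "finite \<sigma>" "card \<sigma> = Suc m"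
  shows "\<exists>\<Phi>. characteristic_map \<sigma> \<Phi>"
proof -
  have "\<exists>h. bij_betw h \<sigma> {..m}"
    using assms by (intro finite_same_card_bij) auto
  then obtain h where h: "bij_betw h \<sigma> {..m}" by blast
  define \<Phi> where "\<Phi> y v = (if v \<in> \<sigma> then 1 / real (Suc m) + displacement m y (h v) else 0)" for y v
  have h_le: "h v \<le> m" if "v \<in> \<sigma>" for v using h that by (auto simp: bij_betw_def)
  have h_onto: "\<exists>v\<in>\<sigma>. h v = i" if "i \<le> m" for i
    using h that by (metis atMost_iff bij_betw_iff_bijections)
  have sum_h: "(\<Sum>v\<in>\<sigma>. f (h v)) = (\<Sum>i\<le>m. f i)" for f :: "nat \<Rightarrow> real"
    using h by (rule sum.reindex_bij_betw)
  have cont: "continuous_on UNIV \<Phi>"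
  proof (rule continuous_on_coordinatewise_then_product)
    fix v show "continuous_on UNIV (\<lambda>y. \<Phi> y v)"
      unfolding \<Phi>_def using continuous_on_displacement h_le
      by (cases "v \<in> \<sigma>") (auto intro!: continuous_intros)
  qed
  have sum1: "sum (\<Phi> y) \<sigma> = 1" for y
  proof -
    have "sum (\<Phi> y) \<sigma> = (\<Sum>v\<in>\<sigma>. 1 / real (Suc m)) + (\<Sum>v\<in>\<sigma>. displacement m y (h v))"
      by (simp add: \<Phi>_def sum.distrib del: of_nat_Suc)
    then show ?thesis using assms sum_h[of "displacement m y"] by (simp add: sum_displacement)
  qed
  have lower: "(1 - disc_norm m y) / real (Suc m) \<le> \<Phi> y v" if "v \<in> \<sigma>" for y v
    using depth_lower[OF h_le[OF that], of "displacement m y"] that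
    by (simp add: \<Phi>_def depth_displacement diff_divide_distrib)
  have attained: "\<exists>v\<in>\<sigma>. \<Phi> y v = (1 - disc_norm m y) / real (Suc m)" for y
  proof -
    obtain i where i: "i \<le> m" "- displacement m y i = disc_norm m y / real (Suc m)"
      using depth_attained[of m "displacement m y"] by (auto simp: depth_displacement)
    obtain v where "v \<in> \<sigma>" "h v = i" using h_onto[OF i(1)] by blast
    then show ?thesis using i by (intro bexI[of _ v]) (auto simp: \<Phi>_def diff_divide_distrib)
  qed
  have supp: "{v. \<Phi> y v \<noteq> 0} \<subseteq> \<sigma>" for y by (auto simp: \<Phi>_def)
  have nonneg: "0 \<le> \<Phi> y v" if "disc_norm m y \<le> 1" for y v
  proof (cases "v \<in> \<sigma>")
    case True
    have "0 \<le> (1 - disc_norm m y) / real (Suc m)" using that by simp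
    then show ?thesis using lower[OF True, of y] by linarith
  qed (simp add: \<Phi>_def)
  have in_cell: "\<Phi> y \<in> open_cell {v. \<Phi> y v \<noteq> 0}" "{v. \<Phi> y v \<noteq> 0} \<in> Pow \<sigma> - {{}}"
    if "disc_norm m y \<le> 1" for y
  proof -
    have s: "sum (\<Phi> y) {v. \<Phi> y v \<noteq> 0} = 1"
      using sum1[of y] sum_support[OF assms(1) supp, of y] by simp
    then show "\<Phi> y \<in> open_cell {v. \<Phi> y v \<noteq> 0}" using nonneg[OF that] by (simp add: open_cell_def)
    have "{v. \<Phi> y v \<noteq> 0} \<noteq> {}"
    proof
      assume "{v. \<Phi> y v \<noteq> 0} = {}"
      with s show False by (simp only: sum.empty)
    qed
    then show "{v. \<Phi> y v \<noteq> 0} \<in> Pow \<sigma> - {{}}" using supp by auto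
  qed
  have inj: "inj_on \<Phi> (unit_disc m)"
  proof (rule inj_onI)
    fix y y' assume y: "y \<in> unit_disc m" "y' \<in> unit_disc m" and eq: "\<Phi> y = \<Phi> y'"
    have "displacement m y i = displacement m y' i" if i: "i \<le> m" for i
    proof -
      obtain v where "v \<in> \<sigma>" "h v = i" using h_onto[OF i] by blast
      then show ?thesis using fun_cong[OF eq, of v] by (simp add: \<Phi>_def)
    qed
    then have "y i = y' i" if "i < m" for i using displacement_inj that by blast
    moreover have "y i = y' i" if "\<not> i < m" for i
      using y that by (simp add: unit_disc_def topspace_Euclidean_space)
    ultimately show "y = y'" by blast
  qed
  have "\<Phi> ` unit_open_disc m = open_cell \<sigma>"
  proof (intro equalityI subsetI)
    fix x assume "x \<in> \<Phi> ` unit_open_disc m"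
    then obtain y where y: "disc_norm m y < 1" "x = \<Phi> y" by (auto simp: unit_disc_eq)
    have "0 < \<Phi> y v" if "v \<in> \<sigma>" for v
    proof -
      have "0 < (1 - disc_norm m y) / real (Suc m)" using y by simp
      then show ?thesis using lower[OF that, of y] by linarith
    qed
    then have "{v. \<Phi> y v \<noteq> 0} = \<sigma>" using supp by force
    then show "x \<in> open_cell \<sigma>" using in_cell(1)[of y] y by simp
  next
    fix x assume x: "x \<in> open_cell \<sigma>"
    define w where "w i = x (inv_into \<sigma> h i) - 1 / real (Suc m)" for i
    have inv: "inv_into \<sigma> h (h v) = v" if "v \<in> \<sigma>" for v
      using h that by (auto simp: bij_betw_def)
    have wh: "w (h v) = x v - 1 / real (Suc m)" if "v \<in> \<sigma>" for v using inv[OF that] by (simp add: w_def)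
    have "(\<Sum>i\<le>m. w i) = (\<Sum>v\<in>\<sigma>. x v - 1 / real (Suc m))"
      unfolding sum_h[symmetric] using wh by simp
    also have "\<dots> = 0" using x assms by (simp add: sum_subtractf open_cell_def)
    finally obtain y where y: "y \<in> topspace (Euclidean_space m)" "\<forall>i\<le>m. displacement m y i = w i"
      using displacement_surj by blast
    have eq: "\<Phi> y = x"
    proof
      fix v show "\<Phi> y v = x v"
        using y(2) wh[of v] h_le[of v] x by (cases "v \<in> \<sigma>") (auto simp: \<Phi>_def open_cell_def)
    qed
    obtain v where "v \<in> \<sigma>" "x v = (1 - disc_norm m y) / real (Suc m)" using attained[of y] eq by auto
    moreover have "x v > 0" using x \<open>v \<in> \<sigma>\<close> by (auto simp: open_cell_def less_le)
    ultimately have "disc_norm m y < 1" by (simp add: zero_less_divide_iff)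
    then show "x \<in> \<Phi> ` unit_open_disc m" using y eq by (auto simp: unit_disc_eq)
  qed
  moreover have "\<Phi> ` unit_disc m \<subseteq> (\<Union>\<tau>\<in>Pow \<sigma> - {{}}. open_cell \<tau>)"
  proof (rule image_subsetI)
    fix y assume "y \<in> unit_disc m"
    then have "disc_norm m y \<le> 1" by (auto simp: unit_disc_eq)
    from in_cell(2,1)[OF this] show "\<Phi> y \<in> (\<Union>\<tau>\<in>Pow \<sigma> - {{}}. open_cell \<tau>)" by (rule UN_I)
  qed
  moreover have "\<Phi> ` unit_sphere m \<subseteq> (\<Union>\<tau>\<in>Pow \<sigma> - {{}, \<sigma>}. open_cell \<tau>)"
  proof (rule image_subsetI)
    fix y assume "y \<in> unit_sphere m"
    then have y: "disc_norm m y = 1" by (auto simp: unit_disc_eq)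
    then obtain v where "v \<in> \<sigma>" "\<Phi> y v = 0" using attained[of y] by auto
    then have "{v. \<Phi> y v \<noteq> 0} \<noteq> \<sigma>" by auto
    then have "{v. \<Phi> y v \<noteq> 0} \<in> Pow \<sigma> - {{}, \<sigma>}" using in_cell(2)[of y] y by auto
    then show "\<Phi> y \<in> (\<Union>\<tau>\<in>Pow \<sigma> - {{}, \<sigma>}. open_cell \<tau>)" by (rule UN_I) (rule in_cell(1), simp add: y)
  qed
  ultimately have "characteristic_map \<sigma> \<Phi>"
    using cont inj assms by (simp add: characteristic_map_def)
  then show ?thesis by blast
qed

section \<open>The CW structure of a finite simplicial complex\<close>

lemma top_of_set_Euclidean_space:
  assumes "S \<subseteq> topspace (Euclidean_space m)"
  shows "subtopology (Euclidean_space m) S = top_of_set S"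
proof -
  have "{x. \<forall>i\<ge>m. x i = 0} \<inter> S = S" using assms by (auto simp: topspace_Euclidean_space)
  then show ?thesis
    by (simp add: Euclidean_space_def subtopology_subtopology euclidean_product_topology)
qed

lemma compact_unit_disc: "compact (unit_disc m)"
proof -
  have "compactin (powertop_real UNIV) (PiE UNIV (\<lambda>_. {-1..1}))"
    by (subst compactin_PiE) auto
  then have box: "compact (PiE UNIV (\<lambda>_. {-1..1}) :: (nat \<Rightarrow> real) set)"
    by (simp add: euclidean_product_topology)
  have "closed (topspace (Euclidean_space m))"
    using closedin_Euclidean_space[of m] by (simp add: euclidean_product_topology)
  moreover have "closed {y. disc_norm m y \<le> 1}"
    unfolding disc_norm_def by (intro closed_Collect_le continuous_intros continuous_on_coord)
  moreover have disc: "unit_disc m = topspace (Euclidean_space m) \<inter> {y. disc_norm m y \<le> 1}"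
    by (auto simp: unit_disc_eq)
  ultimately have "closed (unit_disc m)" by (metis closed_Int)
  moreover have "unit_disc m \<subseteq> PiE UNIV (\<lambda>_. {-1..1})"
  proof
    fix y assume y: "y \<in> unit_disc m"
    have "\<bar>y i\<bar> \<le> 1" for i
    proof (cases "i < m")
      case True
      then have "(y i)\<^sup>2 \<le> (\<Sum>i<m. (y i)\<^sup>2)" by (intro member_le_sum) auto
      also have "\<dots> \<le> 1" using y by (simp add: unit_disc_def)
      finally show ?thesis by (simp add: abs_square_le_1)
    next
      case False
      then show ?thesis using y by (simp add: unit_disc_def topspace_Euclidean_space)
    qed
    then show "y \<in> PiE UNIV (\<lambda>_. {-1..1})" by (auto simp: abs_le_iff minus_le_iff)
  qed
  ultimately show ?thesis using box by (metis compact_Int_closed inf.absorb_iff2)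
qed

lemma homeomorphic_map_restrict_compact:
  fixes f :: "'a::topological_space \<Rightarrow> 'b::t2_space"
  assumes "compact D" "continuous_on D f" "inj_on f D" "U \<subseteq> D"
  shows "homeomorphic_map (top_of_set U) (top_of_set (f ` U)) f"
proof -
  obtain g where "homeomorphism D (f ` D) f g" using homeomorphism_compact[OF assms(1,2) _ assms(3)] by blast
  then have "homeomorphism U (f ` U) f g"
    using assms(4) by (rule homeomorphism_of_subsets) auto
  then have "homeomorphic_maps (top_of_set U) (top_of_set (f ` U)) f g"
    by (auto simp: homeomorphic_maps_def homeomorphism_def)
  then show ?thesis by (auto simp: homeomorphic_map_maps)
qed

lemma realization_points_open_cells:
  "realization_points K = (\<Union>\<sigma>\<in>K - {{}}. open_cell \<sigma>)"
  by (auto simp: realization_points_def open_cell_def)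

text \<open>
  The cells are the open simplices of the nonempty faces. Closure finiteness and the weak topology come
  from the finiteness of the complex. Over a countable vertex type the ambient function space is
  metrizable, in particular Hausdorff, so that an injective continuous map from a disc is a
  homeomorphism onto its image.
\<close>

lemma simplicial_complex_CW_structure:
  fixes K :: "'v::countable set set"
  assumes "finite K" "simplicial_complex K"
  shows "\<exists>E cdim \<Phi>. CW_structure (geometric_realization K) E cdim \<Phi> \<and>
           (\<forall>e\<in>E. \<exists>\<sigma>\<in>K. cdim e = card \<sigma> - 1)"
proof -
  let ?X = "geometric_realization K"
  have X: "?X = top_of_set (realization_points K)" by (rule geometric_realization_eq)
  have fin: "finite \<sigma>" "card \<sigma> = Suc (card \<sigma> - 1)" if "\<sigma> \<in> K - {{}}" for \<sigma>
    using that assms(2) by (auto simp: simplicial_complex_def card_gt_0_iff)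
  have faces: "\<tau> \<in> K" if "\<tau> \<subseteq> \<sigma>" "\<sigma> \<in> K" for \<sigma> \<tau>
    using that assms(2) by (auto simp: simplicial_complex_def)
  have "\<forall>\<sigma>\<in>K - {{}}. \<exists>\<Phi>. characteristic_map \<sigma> \<Phi>"
    using characteristic_map_exists[OF fin] by blast
  from bchoice[OF this] obtain \<Phi>
    where char: "\<And>\<sigma>. \<sigma> \<in> K - {{}} \<Longrightarrow> characteristic_map \<sigma> (\<Phi> \<sigma>)" by blast
  note \<Phi> = char[unfolded characteristic_map_def]
  \<comment> \<open>A cell determines its simplex: it is the support of any of its points.\<close>
  define supp :: "('v \<Rightarrow> real) set \<Rightarrow> 'v set" where "supp e = {v. (SOME x. x \<in> e) v \<noteq> 0}" for e
  have zero_in: "(\<lambda>_. 0) \<in> unit_open_disc m" for m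
    by (simp add: unit_open_disc_def topspace_Euclidean_space)
  have supp_cell: "supp (open_cell \<sigma>) = \<sigma>" if "\<sigma> \<in> K - {{}}" for \<sigma>
  proof -
    have "open_cell \<sigma> \<noteq> {}" using \<Phi>[OF that] zero_in[of "card \<sigma> - 1"] by blast
    then have "(SOME x. x \<in> open_cell \<sigma>) \<in> open_cell \<sigma>" by (rule some_in_eq[THEN iffD2])
    then show ?thesis by (simp add: supp_def open_cell_def)
  qed
  define E where "E = open_cell ` (K - {{}})"
  define cdim where "cdim e = card (supp e) - 1" for e
  have finE: "finite E" using assms(1) by (simp add: E_def)
  have "CW_structure ?X E cdim (\<lambda>e. \<Phi> (supp e))"
    unfolding CW_structure_def
  proof (intro conjI ballI allI impI)
    show "Hausdorff_space ?X"
      unfolding X by (intro Hausdorff_space_subtopology) simp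
    show "\<Union>E = topspace ?X"
      by (simp add: X E_def realization_points_open_cells)
    show "disjoint E"
      by (auto simp: E_def disjoint_def open_cell_def)
  next
    fix e assume "e \<in> E"
    then obtain \<sigma> where \<sigma>: "\<sigma> \<in> K - {{}}" "e = open_cell \<sigma>" by (auto simp: E_def)
    define m where "m = card \<sigma> - 1"
    have [simp]: "supp e = \<sigma>" "cdim e = m" using supp_cell \<sigma> by (simp_all add: cdim_def m_def)
    have cont: "continuous_on (unit_disc m) (\<Phi> \<sigma>)"
      by (rule continuous_on_subset[of UNIV]) (use \<Phi>[OF \<sigma>(1)] in auto)
    have inj: "inj_on (\<Phi> \<sigma>) (unit_disc m)"
      and cell: "\<Phi> \<sigma> ` unit_open_disc m = open_cell \<sigma>"
      and closed: "\<Phi> \<sigma> ` unit_disc m \<subseteq> (\<Union>\<tau>\<in>Pow \<sigma> - {{}}. open_cell \<tau>)"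
      and sphere: "\<Phi> \<sigma> ` unit_sphere m \<subseteq> (\<Union>\<tau>\<in>Pow \<sigma> - {{}, \<sigma>}. open_cell \<tau>)"
      using \<Phi>[OF \<sigma>(1)] by (simp_all add: m_def)
    have disc: "subtopology (Euclidean_space m) (unit_disc m) = top_of_set (unit_disc m)"
      "subtopology (Euclidean_space m) (unit_open_disc m) = top_of_set (unit_open_disc m)"
      by (intro top_of_set_Euclidean_space; auto simp: unit_disc_def unit_open_disc_def)+
    have "(\<Union>\<tau>\<in>Pow \<sigma> - {{}}. open_cell \<tau>) \<subseteq> realization_points K"
      unfolding realization_points_open_cells using faces \<sigma> by blast
    with closed have "\<Phi> \<sigma> ` unit_disc m \<subseteq> realization_points K" by (rule subset_trans)
    then show "continuous_map (subtopology (Euclidean_space (cdim e)) (unit_disc (cdim e))) ?X (\<Phi> (supp e))"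
      using cont by (auto simp: disc X)
    have "unit_open_disc m \<subseteq> unit_disc m" by (auto simp: unit_open_disc_def unit_disc_def)
    then have "homeomorphic_map (top_of_set (unit_open_disc m)) (top_of_set (\<Phi> \<sigma> ` unit_open_disc m)) (\<Phi> \<sigma>)"
      by (rule homeomorphic_map_restrict_compact[OF compact_unit_disc cont inj])
    moreover have "subtopology ?X e = top_of_set e"
      using \<sigma> by (auto simp: X subtopology_subtopology realization_points_open_cells intro!: arg_cong[where f = top_of_set])
    ultimately show "homeomorphic_map (subtopology (Euclidean_space (cdim e)) (unit_open_disc (cdim e)))
        (subtopology ?X e) (\<Phi> (supp e))"
      using cell[folded \<sigma>(2)] by (simp add: disc)
    show "\<exists>F\<subseteq>E. finite F \<and> (\<forall>f\<in>F. cdim f < cdim e) \<and>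
        \<Phi> (supp e) ` unit_sphere (cdim e) \<subseteq> \<Union> F"
    proof (intro exI[of _ "open_cell ` (Pow \<sigma> - {{}, \<sigma>})"] conjI ballI)
      show sub: "open_cell ` (Pow \<sigma> - {{}, \<sigma>}) \<subseteq> E" using faces \<sigma> by (auto simp: E_def)
      then show "finite (open_cell ` (Pow \<sigma> - {{}, \<sigma>}))" using finE by (rule finite_subset)
      show "\<Phi> (supp e) ` unit_sphere (cdim e) \<subseteq> \<Union> (open_cell ` (Pow \<sigma> - {{}, \<sigma>}))"
        using sphere by simp
    next
      fix f assume "f \<in> open_cell ` (Pow \<sigma> - {{}, \<sigma>})"
      then obtain \<tau> where \<tau>: "\<tau> \<subset> \<sigma>" "\<tau> \<noteq> {}" "f = open_cell \<tau>" by auto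
      then have "\<tau> \<in> K - {{}}" using faces \<sigma> by auto
      then have "cdim f = card \<tau> - 1" "0 < card \<tau>" using supp_cell fin \<tau> by (auto simp: cdim_def card_gt_0_iff)
      moreover have "card \<tau> < card \<sigma>" using \<tau> fin[OF \<sigma>(1)] by (intro psubset_card_mono) auto
      ultimately show "cdim f < cdim e" by (simp add: m_def)
    qed
  next
    fix A assume A: "A \<subseteq> topspace ?X" "\<forall>e\<in>E. closedin ?X (A \<inter> ?X closure_of e)"
    have "A = (\<Union>e\<in>E. A \<inter> ?X closure_of e)"
    proof -
      have sub: "e \<subseteq> ?X closure_of e" if "e \<in> E" for e
        using that by (intro closure_of_subset) (auto simp: X E_def realization_points_open_cells)
      have "A \<subseteq> \<Union>E" using A(1) by (simp add: X E_def realization_points_open_cells)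
      then have "a \<in> (\<Union>e\<in>E. A \<inter> ?X closure_of e)" if a: "a \<in> A" for a
      proof -
        obtain e where "e \<in> E" "a \<in> e" using a \<open>A \<subseteq> \<Union>E\<close> by auto
        then show ?thesis using a sub[OF \<open>e \<in> E\<close>] by auto
      qed
      then show ?thesis by auto
    qed
    moreover have "closedin ?X (\<Union>e\<in>E. A \<inter> ?X closure_of e)"
      using A(2) finE by (intro closedin_Union) auto
    ultimately show "closedin ?X A" by simp
  qed
  moreover have "\<forall>e\<in>E. \<exists>\<sigma>\<in>K. cdim e = card \<sigma> - 1"
    using supp_cell by (auto simp: E_def cdim_def)
  ultimately show ?thesis by blast
qed

section \<open>An acyclic matching on the van der Waerden complex\<close>

definition gap :: "nat set \<Rightarrow> nat" where
  "gap F = Gcd ((\<lambda>a. a - Min F) ` F)"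

definition block :: "nat \<Rightarrow> nat \<Rightarrow> nat \<Rightarrow> nat set set" where
  "block x y g = {F. finite F \<and> F \<noteq> {} \<and> Min F = x \<and> Max F = y \<and> gap F = g}"

lemma gap_dvd: "a \<in> F \<Longrightarrow> gap F dvd a - Min F"
  by (simp add: gap_def)

lemma blockD:
  assumes "F \<in> block x y g"
  shows "finite F" "x \<in> F" "y \<in> F" "gap F = g"
    "a \<in> F \<Longrightarrow> x \<le> a" "a \<in> F \<Longrightarrow> a \<le> y" "a \<in> F \<Longrightarrow> g dvd a - x"
  using assms Min_in[of F] Max_in[of F] gap_dvd[of _ F] by (auto simp: block_def)

text \<open>
  A set of multiples of \<open>g\<close> that contains \<open>y - x\<close> has greatest common divisor exactly \<open>g\<close> unless all its
  elements are multiples of \<open>g * p\<close> for a prime \<open>p\<close>, and \<open>p\<close> must then divide \<open>(y - x) div g\<close>. The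
  truncated difference \<open>a - x\<close> is the true one because \<open>a > x\<close> for all \<open>a \<in> V\<close>.
\<close>

lemma block_eq_joins:
  assumes "x < y" "g dvd y - x"
  defines "V \<equiv> {a. x < a \<and> a < y \<and> g dvd a - x}"
    and "\<N> \<equiv> (\<lambda>p. {a. g * p dvd a - x}) ` prime_factors ((y - x) div g)"
  shows "block x y g = insert x ` insert y ` {A. A \<subseteq> V \<and> (\<forall>N\<in>\<N>. \<not> A \<subseteq> N)}"
proof (intro equalityI subsetI)
  have g: "0 < g" using assms(1,2) by (cases "g = 0") auto
  have q: "y - x = g * ((y - x) div g)" using assms(2) by simp
  then have q0: "(y - x) div g \<noteq> 0" using assms(1) by (intro notI) simp
  fix F
  {
    assume F: "F \<in> block x y g"
    define A where "A = F - {x, y}"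
    have FA: "F = insert x (insert y A)" using blockD(2,3)[OF F] by (auto simp: A_def)
    have "A \<subseteq> V"
      using blockD(5-7)[OF F] by (force simp: A_def V_def)
    moreover have "\<not> A \<subseteq> N" if "N \<in> \<N>" for N
    proof
      assume "A \<subseteq> N"
      from that obtain p where p: "p \<in> prime_factors ((y - x) div g)" "N = {a. g * p dvd a - x}"
        by (auto simp: \<N>_def)
      have "g * p dvd y - x"
        using p(1) q by (metis in_prime_factors_imp_dvd mult_dvd_mono dvd_refl)
      then have "g * p dvd a - x" if "a \<in> F" for a
        using that \<open>A \<subseteq> N\<close> p(2) by (auto simp: FA)
      then have "g * p dvd gap F"
        using F unfolding gap_def block_def by (auto intro!: Gcd_greatest)
      then have "p = 1" using blockD(4)[OF F] g by simp
      then show False using p(1) by (auto dest: in_prime_factors_imp_prime)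
    qed
    ultimately have "A \<in> {A. A \<subseteq> V \<and> (\<forall>N\<in>\<N>. \<not> A \<subseteq> N)}" by simp
    then show "F \<in> insert x ` insert y ` {A. A \<subseteq> V \<and> (\<forall>N\<in>\<N>. \<not> A \<subseteq> N)}"
      unfolding FA by (intro imageI)
  next
    assume "F \<in> insert x ` insert y ` {A. A \<subseteq> V \<and> (\<forall>N\<in>\<N>. \<not> A \<subseteq> N)}"
    then obtain A where A: "A \<subseteq> V" "\<forall>N\<in>\<N>. \<not> A \<subseteq> N" "F = insert x (insert y A)" by auto
    have "finite V" by (rule finite_subset[of _ "{..y}"]) (auto simp: V_def)
    then have fin: "finite F" using A finite_subset by auto
    have Min: "Min F = x" using A assms(1) fin by (intro Min_eqI) (auto simp: V_def)
    have Max: "Max F = y" using A assms(1) fin by (intro Max_eqI) (auto simp: V_def)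
    have "gap F dvd y - x" using gap_dvd[of y F] A Min by simp
    have "g dvd gap F"
      unfolding gap_def Min using A assms(2) by (auto intro!: Gcd_greatest simp: V_def)
    then obtain q where q: "gap F = g * q" by (elim dvdE)
    have "q = 1"
    proof (rule ccontr)
      assume "q \<noteq> 1"
      then obtain p where p: "prime p" "p dvd q" using prime_factor_nat by blast
      have "g * q dvd g * ((y - x) div g)" using \<open>gap F dvd y - x\<close> q assms(2) by simp
      then have "q dvd (y - x) div g" using g by simp
      then have "p \<in> prime_factors ((y - x) div g)"
        using p q0 by (auto simp: prime_factors_dvd intro: dvd_trans)
      then have "{a. g * p dvd a - x} \<in> \<N>" by (auto simp: \<N>_def)
      with A(2) have "\<not> A \<subseteq> {a. g * p dvd a - x}" by (rule bspec)
      moreover have "g * p dvd a - x" if "a \<in> A" for a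
      proof -
        have "g * p dvd gap F" using p q by simp
        also have "gap F dvd a - x" using gap_dvd[of a F] that A Min by simp
        finally show ?thesis .
      qed
      ultimately show False by auto
    qed
    then show "F \<in> block x y g" using fin A(3) Min Max q by (simp add: block_def)
  }
qed

lemma morse_family_block:
  assumes "x < y" "g dvd y - x" "card (prime_factors ((y - x) div g)) \<le> R"
  shows "morse_family (R + 2) (block x y g)"
proof -
  define V where "V = {a. x < a \<and> a < y \<and> g dvd a - x}"
  define \<N> where "\<N> = (\<lambda>p. {a. g * p dvd a - x}) ` prime_factors ((y - x) div g)"
  let ?C = "{A. A \<subseteq> V \<and> (\<forall>N\<in>\<N>. \<not> A \<subseteq> N)}"
  have "finite V" by (rule finite_subset[of _ "{..y}"]) (auto simp: V_def)
  then have "morse_family (card \<N>) ?C" by (rule morse_family_avoiding) (simp add: \<N>_def)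
  then have "morse_family (Suc (card \<N>)) (insert y ` ?C)"
    by (rule morse_family_insert_image) (auto simp: V_def)
  then have "morse_family (Suc (Suc (card \<N>))) (insert x ` insert y ` ?C)"
    by (rule morse_family_insert_image) (use assms(1) in \<open>auto simp: V_def\<close>)
  moreover have "card \<N> \<le> R"
    using assms(3) card_image_le[of "prime_factors ((y - x) div g)"] by (auto simp: \<N>_def intro: le_trans)
  ultimately show ?thesis
    using block_eq_joins[OF assms(1,2)] unfolding V_def \<N>_def
    by (auto elim!: morse_family_mono)
qed

lemma arith_prog_subset: "1 \<le> x \<Longrightarrow> x + k * d \<le> n \<Longrightarrow> arith_prog x d k \<subseteq> {1..n}"
  unfolding arith_prog_def by (auto intro: order_trans[OF add_left_mono[OF mult_le_mono1]])

lemma vdW_subset_Pow: "vdW n k \<subseteq> Pow {1..n}"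
  using arith_prog_subset unfolding vdW_def by blast

lemma finite_vdW: "finite (vdW n k)"
  by (rule finite_subset[OF vdW_subset_Pow]) simp

lemma simplicial_complex_vdW: "simplicial_complex (vdW n k)"
  unfolding simplicial_complex_def
proof (intro ballI conjI allI impI)
  fix A B assume A: "A \<in> vdW n k"
  then have "A \<subseteq> {1..n}" using vdW_subset_Pow by blast
  then show "finite A" by (rule finite_subset) simp
  assume "B \<subseteq> A"
  with A show "B \<in> vdW n k" unfolding vdW_def by (auto simp: subset_singleton_iff) blast+
qed

text \<open>
  A progression with difference \<open>d\<close> that contains \<open>F\<close> satisfies \<open>d dvd g\<close>; it therefore contains all
  points \<open>x + g i\<close> up to \<open>y\<close>, hence every set in the block. Its length bounds \<open>(y - x) div d\<close>, and a
  fortiori \<open>(y - x) div g\<close>.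
\<close>

lemma vdW_block_cases:
  assumes "x < y" "F \<in> block x y g" "F \<in> vdW n k"
  shows "block x y g \<subseteq> vdW n k" "(y - x) div g \<le> k"
proof -
  have "x \<in> F" "y \<in> F" using blockD[OF assms(2)] by auto
  then obtain x' d where d: "0 < d" "1 \<le> x'" "x' < x' + k * d" "x' + k * d \<le> n" "F \<subseteq> arith_prog x' d k"
    using assms(1,3) by (auto simp: vdW_def)
  obtain i where i: "x = x' + i * d" using d \<open>x \<in> F\<close> by (auto simp: arith_prog_def)
  have y: "y \<le> x' + k * d" using d \<open>y \<in> F\<close> by (auto simp: arith_prog_def)
  have "d dvd a - x" if "a \<in> F" for a
    using that d i by (auto simp: arith_prog_def diff_mult_distrib[symmetric])
  then have dg: "d dvd g"
    using assms(2) unfolding block_def gap_def by (auto intro!: Gcd_greatest)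
  show "block x y g \<subseteq> vdW n k"
  proof
    fix F' assume F': "F' \<in> block x y g"
    have "a \<in> arith_prog x' d k" if a: "a \<in> F'" for a
    proof -
      have "d dvd a - x" using dg blockD(7)[OF F' a] by (rule dvd_trans)
      then obtain j where "a - x = d * j" by (elim dvdE)
      then have aj: "a = x' + (i + j) * d" using blockD(5)[OF F' a] i by (simp add: algebra_simps)
      then have "(i + j) * d \<le> k * d" using blockD(6)[OF F' a] y by linarith
      then have "i + j \<le> k" using d(1) by simp
      then show ?thesis using aj unfolding arith_prog_def by blast
    qed
    then show "F' \<in> vdW n k" using d unfolding vdW_def by blast
  qed
  have "0 < g" using blockD(7)[OF assms(2) \<open>y \<in> F\<close>] assms(1) by (cases "g = 0") auto
  have "y - x \<le> k * d" using y i by simp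
  also have "\<dots> \<le> k * g" using dg \<open>0 < g\<close> by (simp add: dvd_imp_le)
  finally show "(y - x) div g \<le> k" using \<open>0 < g\<close> by (metis div_le_mono nonzero_mult_div_cancel_right not_gr_zero)
qed

text \<open>
  Under inclusion the maximum grows, for a fixed maximum the minimum decreases, and for fixed maximum and
  minimum the gap passes to a divisor. So the blocks can be stacked by three applications of the
  patchwork principle.
\<close>

lemma morse_family_vdW:
  assumes "\<And>m. 1 \<le> m \<Longrightarrow> m \<le> k \<Longrightarrow> card (prime_factors m) \<le> R"
  shows "morse_family (R + 2) (vdW n k)"
proof -
  define C where "C = vdW n k - {{}}"
  have finC: "finite C" by (simp add: C_def finite_vdW)
  have fin: "finite A" "A \<noteq> {}" if "A \<in> C" for A
    using that simplicial_complex_vdW by (auto simp: C_def simplicial_complex_def)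
  have fiber: "{A \<in> C. Max A = y \<and> Min A = x \<and> gap A = g} = vdW n k \<inter> block x y g" for x y g
    using fin by (auto simp: block_def C_def)
  have "morse_family (R + 2) C"
  proof (rule morse_family_fibers[where f = Max])
    show "Max A \<le> Max B" if "A \<in> C" "B \<in> C" "A \<subseteq> B" for A B
      using that fin by (intro Max_mono) auto
    fix y
    show "morse_family (R + 2) {A \<in> C. Max A = y}"
    proof (rule morse_family_fibers[where f = "\<lambda>A. - int (Min A)"])
      show "- int (Min A) \<le> - int (Min B)"
        if "A \<in> {A \<in> C. Max A = y}" "B \<in> {A \<in> C. Max A = y}" "A \<subseteq> B" for A B
        using that fin by (auto intro!: Min_antimono)
      fix b
      define x where "x = nat (- b)"
      show "morse_family (R + 2) {A \<in> {A \<in> C. Max A = y}. - int (Min A) = b}"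
      proof (cases "b \<le> 0 \<and> x < y")
        case True
        have eq: "{A \<in> {A \<in> C. Max A = y}. - int (Min A) = b} = {A \<in> C. Max A = y \<and> Min A = x}"
          using True by (auto simp: x_def)
        show ?thesis unfolding eq
        proof (rule morse_family_fibers[where f = "\<lambda>A. - int (gap A)"])
          show "- int (gap A) \<le> - int (gap B)"
            if A: "A \<in> {A \<in> C. Max A = y \<and> Min A = x}" and B: "B \<in> {A \<in> C. Max A = y \<and> Min A = x}"
              and "A \<subseteq> B" for A B
          proof -
            have "gap B dvd gap A"
              using A B \<open>A \<subseteq> B\<close> unfolding gap_def by (auto intro!: Gcd_greatest)
            moreover have "gap A dvd y - x" using gap_dvd[of y A] A fin Max_in[of A] by auto
            then have "0 < gap A" using True by (cases "gap A = 0") auto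
            ultimately show ?thesis by (simp add: dvd_imp_le)
          qed
          fix c
          define g where "g = nat (- c)"
          show "morse_family (R + 2) {A \<in> {A \<in> C. Max A = y \<and> Min A = x}. - int (gap A) = c}" (is "morse_family _ ?S")
          proof (cases "?S = {}")
            case False
            then have "?S = {A \<in> C. Max A = y \<and> Min A = x \<and> gap A = g}" by (auto simp: g_def)
            then have S: "?S = vdW n k \<inter> block x y g" using fiber by simp
            with False obtain F where F: "F \<in> vdW n k" "F \<in> block x y g" by auto
            have "?S = block x y g" using S vdW_block_cases(1)[OF _ F(2,1)] True by auto
            moreover have g: "g dvd y - x" using blockD(3,7)[OF F(2)] by auto
            moreover have "1 \<le> (y - x) div g"
              using g True by (metis One_nat_def Suc_leI dvd_div_eq_0_iff gr0I zero_less_diff)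
            then have "card (prime_factors ((y - x) div g)) \<le> R"
              using vdW_block_cases(2)[OF _ F(2,1)] True by (intro assms) auto
            ultimately show ?thesis using morse_family_block True by simp
          qed (simp only: morse_family.empty)
        qed (use finC in simp)
      next
        case False
        have "A = {y}" if "A \<in> {A \<in> {A \<in> C. Max A = y}. - int (Min A) = b}" for A
        proof -
          \<comment> \<open>Here the minimum is not below the maximum, and the only possible face is \<open>{y}\<close>.\<close>
          have A: "finite A" "A \<noteq> {}" "Max A = y" "b = - int (Min A)"
            using that fin by auto
          have "\<not> Min A < y" using False A(4) by (auto simp: x_def)
          then have "y \<le> Min A" by linarith
          have "a = y" if a: "a \<in> A" for a
            using Min_le[OF A(1) a] Max_ge[OF A(1) a] A(3) \<open>y \<le> Min A\<close> by linarith
          then show ?thesis using A(2) by blast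
        qed
        then have "{A \<in> {A \<in> C. Max A = y}. - int (Min A) = b} \<subseteq> {{y}}"
          by (intro subsetI) simp
        then have "{A \<in> {A \<in> C. Max A = y}. - int (Min A) = b} = {}
          \<or> {A \<in> {A \<in> C. Max A = y}. - int (Min A) = b} = {{y}}"
          by (simp only: subset_singleton_iff)
        moreover have "morse_family (R + 2) {{y}}"
          by (intro morse_family.critical morse_family.empty) auto
        ultimately show ?thesis by (elim disjE; simp only: morse_family.empty)
      qed
    qed (use finC in simp)
  qed (rule finC)
  moreover have "morse_family (R + 2) {{}}"
    by (intro morse_family.critical morse_family.empty) auto
  ultimately have "morse_family (R + 2) (C \<union> {{}})"
    by (rule morse_family_Un) (auto simp: C_def)
  moreover have "C \<union> {{}} = vdW n k" by (auto simp: C_def vdW_def)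
  ultimately show ?thesis by simp
qed

section \<open>The number of prime factors\<close>

text \<open>
  The \<open>i\<close>-th smallest element of a set of positive integers is at least \<open>i\<close>.
\<close>

lemma fact_card_le_prod:
  fixes S :: "nat set"
  assumes "finite S"
  shows "0 \<notin> S \<Longrightarrow> fact (card S) \<le> \<Prod>S"
  using assms
proof (induction S rule: finite_linorder_max_induct)
  case (insert b S)
  have "S \<subseteq> {1..<b}"
  proof
    fix a assume "a \<in> S"
    then have "a < b" using insert.hyps(2) by simp
    moreover have "a \<noteq> 0" using \<open>a \<in> S\<close> insert.prems by (intro notI) simp
    ultimately show "a \<in> {1..<b}" by simp
  qed
  then have "card S \<le> b - 1" using card_mono[of "{1..<b}" S] by simp
  then have "Suc (card S) \<le> b" using insert.prems by auto
  then have "Suc (card S) * fact (card S) \<le> b * \<Prod>S"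
    using insert by (intro mult_mono) auto
  moreover have "b \<notin> S" using insert by auto
  ultimately show ?case using insert.hyps(1) by simp
qed simp

lemma fact_card_prime_factors_le:
  assumes "1 \<le> (m::nat)"
  shows "fact (card (prime_factors m)) \<le> m"
proof -
  have "fact (card (prime_factors m)) \<le> \<Prod>(prime_factors m)"
    by (rule fact_card_le_prod) auto
  also have "\<dots> \<le> (\<Prod>p\<in>prime_factors m. p ^ multiplicity p m)"
    by (intro prod_mono) (auto simp: prime_factors_multiplicity intro!: self_le_power dest: prime_gt_0_nat)
  also have "\<dots> = m" using assms by (intro prime_factorization_nat[symmetric]) auto
  finally show ?thesis .
qed

text \<open>
  Comparing \<open>exp r\<close> with the term of index \<open>r\<close> of its power series gives \<open>r ^ r / r! \<le> exp r\<close>.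
\<close>

lemma ln_fact_lower: "0 < r \<Longrightarrow> real r * (ln (real r) - 1) \<le> ln (fact r)"
proof -
  assume r: "0 < r"
  have "real r ^ r / fact r \<le> exp (real r)"
  proof -
    have S: "(\<lambda>n. real r ^ n /\<^sub>R fact n) sums exp (real r)" by (rule exp_converges)
    have "(\<Sum>n\<in>{r}. real r ^ n /\<^sub>R fact n) \<le> (\<Sum>n. real r ^ n /\<^sub>R fact n)"
      using sums_summable[OF S] by (intro sum_le_suminf) auto
    also have "\<dots> = exp (real r)" using sums_unique[OF S] by simp
    finally show ?thesis by (simp add: divide_inverse mult.commute)
  qed
  then have "ln (real r ^ r / fact r) \<le> ln (exp (real r))"
    using r by (intro ln_mono) auto
  then show ?thesis using r by (simp add: ln_div ln_realpow algebra_simps)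
qed

text \<open>
  With \<open>z = (1 + \<delta>) ln k / ln (ln k)\<close>, the quantity \<open>z (ln z - 1)\<close> is asymptotically \<open>(1 + \<delta>) ln k\<close>. Since
  \<open>r (ln r - 1)\<close> increases, more than \<open>z\<close> prime factors would force the factorial of their number to
  exceed \<open>k\<close>.
\<close>

lemma eventually_prime_factors_bound:
  fixes \<delta> :: real
  assumes "\<delta> > 0"
  shows "\<forall>\<^sub>F k::nat in at_top. \<forall>m. 1 \<le> m \<and> m \<le> k \<longrightarrow>
    real (card (prime_factors m)) \<le> (1 + \<delta>) * (ln (real k) / ln (ln (real k)))"
proof -
  define z where "z k = (1 + \<delta>) * (ln (real k) / ln (ln (real k)))" for k
  have "\<forall>\<^sub>F k in at_top. z k \<ge> 1"
    unfolding z_def using assms by real_asymp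
  moreover have "\<forall>\<^sub>F k in at_top. z k * (ln (z k) - 1) > ln (real k)"
    unfolding z_def using assms by real_asymp
  ultimately show ?thesis unfolding z_def[symmetric]
  proof eventually_elim
    case (elim k)
    show ?case
    proof (intro allI impI, rule ccontr)
      fix m assume m: "1 \<le> m \<and> m \<le> k" and "\<not> real (card (prime_factors m)) \<le> z k"
      define r where "r = card (prime_factors m)"
      have r: "z k < real r" using \<open>\<not> _\<close> by (simp add: r_def)
      have k: "0 < ln (z k) - 1"
      proof -
        have "0 \<le> ln (real k)" using m by simp
        then have "0 < z k * (ln (z k) - 1)" using elim by linarith
        then show ?thesis using elim(1) by (simp add: zero_less_mult_iff)
      qed
      have "ln (real k) < z k * (ln (z k) - 1)" by (rule elim)
      also have "\<dots> \<le> real r * (ln (real r) - 1)"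
        using r elim(1) k by (intro mult_mono) auto
      also have "\<dots> \<le> ln (fact r)" using r elim(1) by (intro ln_fact_lower) auto
      also have "\<dots> \<le> ln (real k)"
      proof -
        have "fact r \<le> k" using fact_card_prime_factors_le m unfolding r_def by (meson le_trans)
        then have "(fact r :: real) \<le> real k" by (metis of_nat_fact of_nat_le_iff)
        then show ?thesis by (intro ln_mono) auto
      qed
      finally show False by simp
    qed
  qed
qed

section \<open>The homotopy type of the van der Waerden complex\<close>

theorem theorem3p11:
  fixes \<epsilon> :: real
  assumes "\<epsilon> > 0"
  shows "\<exists>K::nat. \<forall>k\<ge>K. \<forall>n\<ge>1.
           \<exists>(X :: (nat \<Rightarrow> real) topology) E cdim \<Phi>.
             CW_structure X E cdim \<Phi> \<and>
             geometric_realization (vdW n k) homotopy_equivalent_space X \<and>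
             (\<forall>e\<in>E. real (cdim e) \<le> (1 + \<epsilon>) * (ln (real k) / ln (ln (real k))))"
proof -
  define q where "q k = ln (real k) / ln (ln (real k))" for k
  have "\<forall>\<^sub>F k in at_top. 1 \<le> \<epsilon> / 2 * q k"
    unfolding q_def using assms by real_asymp
  moreover have "\<forall>\<^sub>F k in at_top. \<forall>m. 1 \<le> m \<and> m \<le> k \<longrightarrow>
      real (card (prime_factors m)) \<le> (1 + \<epsilon> / 2) * q k"
    unfolding q_def using assms by (intro eventually_prime_factors_bound) simp
  ultimately have "\<forall>\<^sub>F k in at_top. 1 \<le> \<epsilon> / 2 * q k \<and> (\<forall>m. 1 \<le> m \<and> m \<le> k \<longrightarrow>
      real (card (prime_factors m)) \<le> (1 + \<epsilon> / 2) * q k)"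
    by (rule eventually_conj)
  then obtain K where K: "\<And>k. K \<le> k \<Longrightarrow> 1 \<le> \<epsilon> / 2 * q k"
    "\<And>k m. K \<le> k \<Longrightarrow> 1 \<le> m \<Longrightarrow> m \<le> k \<Longrightarrow> real (card (prime_factors m)) \<le> (1 + \<epsilon> / 2) * q k"
    unfolding eventually_at_top_linorder by blast
  show ?thesis
  proof (intro exI[of _ K] allI impI)
    fix k n :: nat
    assume k: "K \<le> k"
    define R where "R = nat \<lfloor>(1 + \<epsilon> / 2) * q k\<rfloor>"
    have "0 < \<epsilon> / 2 * q k" using K(1)[OF k] by linarith
    then have "0 < q k" using assms by (simp add: zero_less_mult_iff)
    then have R: "real R \<le> (1 + \<epsilon> / 2) * q k"
      using assms unfolding R_def by (intro of_nat_floor) simp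
    have "morse_family (R + 2) (vdW n k)"
      using K(2)[OF k] unfolding R_def by (intro morse_family_vdW le_nat_floor)
    then obtain L where L: "collapses (R + 2) (vdW n k) L" "simplicial_complex L"
      "\<forall>A\<in>L. card A \<le> R + 2"
      using morse_family_collapses simplicial_complex_vdW by blast
    have "finite L" using collapses_subset[OF L(1)] finite_vdW by (rule finite_subset)
    then obtain E cdim \<Phi> where CW: "CW_structure (geometric_realization L) E cdim \<Phi>"
      "\<forall>e\<in>E. \<exists>\<sigma>\<in>L. cdim e = card \<sigma> - 1"
      using simplicial_complex_CW_structure L(2) by blast
    have "real (cdim e) \<le> (1 + \<epsilon>) * (ln (real k) / ln (ln (real k)))" if "e \<in> E" for e
    proof -
      from bspec[OF CW(2) that] obtain \<sigma> where \<sigma>: "cdim e = card \<sigma> - 1" "\<sigma> \<in> L"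
        by (rule bexE)
      have "card \<sigma> \<le> R + 2" using L(3) \<sigma>(2) by (rule bspec)
      then have "cdim e \<le> R + 1" using \<sigma>(1) by simp
      then have "real (cdim e) \<le> real R + 1" by linarith
      also have "\<dots> \<le> (1 + \<epsilon> / 2) * q k + \<epsilon> / 2 * q k" using R K(1)[OF k] by linarith
      also have "\<dots> = (1 + \<epsilon>) * q k" by (simp add: algebra_simps)
      finally show ?thesis by (simp add: q_def)
    qed
    moreover have "geometric_realization (vdW n k) homotopy_equivalent_space geometric_realization L"
      using L(1) simplicial_complex_vdW by (rule collapses_homotopy_equivalent) simp
    ultimately show "\<exists>(X :: (nat \<Rightarrow> real) topology) E cdim \<Phi>. CW_structure X E cdim \<Phi> \<and>
        geometric_realization (vdW n k) homotopy_equivalent_space X \<and>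
        (\<forall>e\<in>E. real (cdim e) \<le> (1 + \<epsilon>) * (ln (real k) / ln (ln (real k))))"
      using CW(1) by (intro exI conjI ballI)
  qed
qed

end
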